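(* For every finite simple graph $G$ (with at least one edge), $\frac{\nu(G)}{\alpha_2(G)} \le \frac{5}{4}$.
   Context: Graphs are finite, undirected, without loops or multiple edges. $\nu(G)$ is the size of a maximum matching of $G$. Let $B_2(G)$ be the set of ordered pairs $(H,H')$ of edge-disjoint matchings of $G$, let $\lambda_2(G)=\max\{|H|+|H'| : (H,H')\in B_2(G)\}$, and let $\alpha_2(G)=\max\{|H|,|H'| : (H,H')\in B_2(G),\ |H|+|H'|=\lambda_2(G)\}$. *)

theory Defs
  imports Complex_Main
begin

definition finite_simple_graph :: "'a set \<Rightarrow> 'a set set \<Rightarrow> bool" where
  "finite_simple_graph V E \<longleftrightarrow> finite V \<and> (\<forall>e\<in>E. e \<subseteq> V \<and> card e = 2)"

definition matching :: "'a set set \<Rightarrow> 'a set set \<Rightarrow> bool" where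
  "matching E M \<longleftrightarrow> M \<subseteq> E \<and> pairwise disjnt M"

(* For a finite edge set, all the sets of cardinalities below are finite, and nonempty because
   empty matchings (and empty pairs of matchings) are allowed, so every Max is attained. *)

definition matching_number :: "'a set set \<Rightarrow> nat" where
  "matching_number E = Max {card M | M. matching E M}"

definition B2 :: "'a set set \<Rightarrow> ('a set set \<times> 'a set set) set" where
  "B2 E = {(H, H'). matching E H \<and> matching E H' \<and> H \<inter> H' = {}}"

definition lambda2 :: "'a set set \<Rightarrow> nat" where
  "lambda2 E = Max {card H + card H' | H H'. (H, H') \<in> B2 E}"

definition alpha2 :: "'a set set \<Rightarrow> nat" where
  "alpha2 E = Max (\<Union>(H, H') \<in> {(H, H'). (H, H') \<in> B2 E \<and> card H + card H' = lambda2 E}.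
                     {card H, card H'})"

end

theory Submission
  imports Defs
begin

text \<open>
  Among the optimal pairs \<open>(H, H')\<close> with \<open>|H| = alpha2\<close>, choose one whose union shares as many edges
  as possible with a fixed maximum matching \<open>M\<close>.  Let \<open>S\<close> be the set of vertices covered by \<open>M\<close> but
  not by \<open>H\<close>, and \<open>T\<close> the set of those covered by \<open>H\<close> but not by \<open>M\<close>; then
  \<open>|S| - |T| = 2 (|M| - |H|)\<close>.  By the choice of the pair, the \<open>M\<close>-edge at a vertex \<open>v\<close> of \<open>S\<close> lies
  in \<open>H'\<close>, and it is followed by an \<open>H\<close>-edge with far end \<open>x\<close>.  Either \<open>x\<close> lies in \<open>T\<close>, which happens
  for at most \<open>|T|\<close> vertices \<open>v\<close>, or the component of \<open>H \<union> H'\<close> at \<open>v\<close> continues with an \<open>H'\<close>-edge and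
  another \<open>H\<close>-edge.  The components are paths of even length, since in a path of odd length that
  starts with an \<open>H'\<close>-edge the colours could be interchanged to enlarge \<open>H\<close>; so no two of these
  vertices share a component, and \<open>H\<close> has at least \<open>2 (|S| - |T|)\<close> edges.
\<close>

section \<open>Exchanging edges in a matching\<close>

lemma matching_unique:
  "matching E N \<Longrightarrow> e \<in> N \<Longrightarrow> f \<in> N \<Longrightarrow> x \<in> e \<Longrightarrow> x \<in> f \<Longrightarrow> e = f"
  unfolding matching_def pairwise_def disjnt_def by blast

text \<open>A vertex shared by a kept edge of \<open>N\<close> and an edge of \<open>B\<close> would
  be covered by \<open>A\<close>, so its only \<open>N\<close>-edge has been removed.\<close>

lemma matching_exchange:
  assumes "matching E N" "matching E B" "A \<subseteq> N" "\<Union>B \<inter> \<Union>N \<subseteq> \<Union>A"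
  shows "matching E ((N - A) \<union> B)"
proof -
  have "disjnt e f" if "e \<in> N - A" "f \<in> B" for e f
  proof -
    have "x \<notin> f" if "x \<in> e" for x
      using assms(3,4) matching_unique[OF assms(1), of e _ x] \<open>e \<in> N - A\<close> \<open>f \<in> B\<close> that by blast
    then show ?thesis unfolding disjnt_def by blast
  qed
  then show ?thesis
    using assms(1,2) unfolding matching_def pairwise_def by (auto simp: disjnt_sym)
qed

lemma matching_subset: "matching E N \<Longrightarrow> A \<subseteq> N \<Longrightarrow> matching E A"
  unfolding matching_def pairwise_def by blast

lemma card_exchange:
  assumes "finite N" "A \<subseteq> N" "finite B" "B \<inter> (N - A) = {}" 
  shows "card ((N - A) \<union> B) + card A = card N + card B"
proof -
  have "card ((N - A) \<union> B) = card (N - A) + card B"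
    using assms by (intro card_Un_disjoint) auto
  moreover have "card (N - A) + card A = card N"
    using assms by (metis card_Diff_subset card_mono finite_subset le_add_diff_inverse2)
  ultimately show ?thesis by simp
qed

lemma card_Union_matching:
  assumes "matching E N" "finite E" "\<And>e. e \<in> E \<Longrightarrow> card e = 2"
  shows "card (\<Union>N) = 2 * card N"
proof -
  have "\<forall>e\<in>N. card e = 2" using assms unfolding matching_def by blast
  then have "card (\<Union>N) = sum card N"
    using assms(1) unfolding matching_def
    by (intro card_Union_disjoint) (auto intro: card_ge_0_finite)
  also have "\<dots> = 2 * card N" using \<open>\<forall>e\<in>N. card e = 2\<close> by simp
  finally show ?thesis .
qed

section \<open>Local consequences of the extremal choice of the pair\<close>

locale optimal_triple =
  fixes E H H' M :: "'a set set"
  assumes finE: "finite E" and card2: "\<And>e. e \<in> E \<Longrightarrow> card e = 2"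
    and matH: "matching E H" and matH': "matching E H'" and matM: "matching E M"
    and disj: "H \<inter> H' = {}"
    and opt_sum: "\<And>K K'. (K, K') \<in> B2 E \<Longrightarrow> card K + card K' \<le> card H + card H'"
    and opt_card: "\<And>K K'. (K, K') \<in> B2 E \<Longrightarrow> card K + card K' = card H + card H'
      \<Longrightarrow> card K \<le> card H"
    and opt_inter: "\<And>K K'. (K, K') \<in> B2 E \<Longrightarrow> card K = card H \<Longrightarrow> card K' = card H'
      \<Longrightarrow> card (M \<inter> (K \<union> K')) \<le> card (M \<inter> (H \<union> H'))"
begin

lemma finite_matching: "matching E N \<Longrightarrow> finite N"
  using finE unfolding matching_def by (auto intro: finite_subset)

lemma edge_neq: "matching E N \<Longrightarrow> {x, y} \<in> N \<Longrightarrow> x \<noteq> y"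
  using card2 unfolding matching_def by fastforce

lemma edge_at:
  assumes "matching E N" "x \<in> \<Union>N"
  obtains y where "{x, y} \<in> N"
proof -
  obtain e where e: "e \<in> N" "x \<in> e" using assms by blast
  then have "card e = 2" using assms card2 unfolding matching_def by blast
  then obtain a b where "e = {a, b}" by (auto simp: card_2_iff)
  then show ?thesis using e that by (metis doubleton_eq_iff insertE singletonD)
qed

lemma mate_unique:
  assumes "matching E N" "{x, y} \<in> N" "{x, z} \<in> N"
  shows "y = z"
  using matching_unique[OF assms, of x] by (auto simp: doubleton_eq_iff)

text \<open>The hypotheses make \<open>A \<union> B\<close> a union of components of
  \<open>H \<union> H'\<close>. Interchanging the colours there keeps the total size, so it cannot
  enlarge \<open>H\<close>.\<close>

lemma switch_le:
  assumes "A \<subseteq> H" "B \<subseteq> H'" "\<Union>B \<inter> \<Union>H \<subseteq> \<Union>A" "\<Union>A \<inter> \<Union>H' \<subseteq> \<Union>B"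
  shows "card B \<le> card A"
proof -
  let ?K = "(H - A) \<union> B" and ?K' = "(H' - B) \<union> A"
  have fin: "finite H" "finite H'" "finite A" "finite B"
    using matH matH' finite_matching assms finite_subset by blast+
  have "matching E A" "matching E B" using matH matH' assms matching_subset by blast+
  then have "matching E ?K" "matching E ?K'"
    using matching_exchange matH matH' assms by blast+
  then have B2: "(?K, ?K') \<in> B2 E" using assms disj unfolding B2_def by blast
  have 1: "card ?K + card A = card H + card B"
    using fin assms disj by (intro card_exchange) auto
  have 2: "card ?K' + card B = card H' + card A"
    using fin assms disj by (intro card_exchange) auto
  show ?thesis using opt_card[OF B2] 1 2 by linarith
qed

text \<open>Otherwise \<open>{v, w}\<close> could enter \<open>H\<close>: either the total grows, or
  the edge replaces the \<open>H\<close>-edge at \<open>w\<close> and the overlap with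
  \<open>M\<close> grows.\<close>

lemma M_edge_in_H':
  assumes v: "v \<notin> \<Union>H" and e: "{v, w} \<in> M"
  shows "{v, w} \<in> H'"
proof (rule ccontr)
  assume e': "{v, w} \<notin> H'"
  have eH: "{v, w} \<notin> H" using v by blast
  have mat1: "matching E {{v, w}}" using matM e unfolding matching_def by auto
  have fin: "finite H" "finite H'" "finite M" using matH matH' matM finite_matching by blast+
  show False
  proof (cases "w \<in> \<Union>H")
    case False
    have "matching E ((H - {}) \<union> {{v, w}})"
      using matH mat1 v False by (intro matching_exchange) auto
    then have "(insert {v, w} H, H') \<in> B2 E"
      using matH' disj e' unfolding B2_def by auto
    then show False using opt_sum[of "insert {v, w} H" H'] fin eH by simp
  next
    case True
    then obtain x where x: "{w, x} \<in> H" using edge_at[OF matH] by blast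
    let ?K = "(H - {{w, x}}) \<union> {{v, w}}"
    have "matching E ?K"
      using matH mat1 v x by (intro matching_exchange) auto
    then have B2: "(?K, H') \<in> B2 E" using matH' disj e' unfolding B2_def by auto
    have "card ?K + card {{w, x}} = card H + card {{v, w}}"
      using fin x eH by (intro card_exchange) auto
    then have le: "card (M \<inter> (?K \<union> H')) \<le> card (M \<inter> (H \<union> H'))"
      using opt_inter[OF B2] by simp
    have "{w, x} \<notin> M" using matching_unique[OF matM e, of "{w, x}" w] x v by auto
    then have "M \<inter> (?K \<union> H') = insert {v, w} (M \<inter> (H \<union> H'))" using e by auto
    then show False using le fin eH e' by simp
  qed
qed

text \<open>If \<open>H\<close> missed \<open>w\<close> as well, \<open>{v, w}\<close> would be a
  component by itself, and moving it to \<open>H\<close> would enlarge \<open>H\<close>.\<close>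

lemma step_H:
  assumes v: "v \<notin> \<Union>H" and e: "{v, w} \<in> H'"
  obtains x where "{w, x} \<in> H"
proof -
  have "w \<in> \<Union>H"
  proof (rule ccontr)
    assume "w \<notin> \<Union>H"
    then have "card {{v, w}} \<le> card ({} :: 'a set set)" using v e by (intro switch_le) auto
    then show False by simp
  qed
  then show ?thesis using edge_at[OF matH] that by blast
qed

lemma step_H':
  assumes v: "v \<notin> \<Union>H" and e1: "{v, w} \<in> H'" "{v, w} \<in> M" and e2: "{w, x} \<in> H"
    and x: "x \<in> \<Union>M"
  obtains y where "{x, y} \<in> H'"
proof -
  have "x \<in> \<Union>H'"
  proof (rule ccontr)
    assume x': "x \<notin> \<Union>H'"
    obtain y where e3: "{x, y} \<in> M" using x edge_at[OF matM] by blast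
    have e3': "{x, y} \<notin> H'" using x' by blast
    have neq: "w \<noteq> x" "v \<noteq> w" "x \<noteq> y" "v \<noteq> x"
      using edge_neq[OF matH e2] edge_neq[OF matM e1(2)] edge_neq[OF matM e3] v e2 by auto
    have "y \<noteq> w" using mate_unique[OF matM, of w v x] e1(2) e3 neq
      by (metis insert_commute)
    have "y \<noteq> v" using mate_unique[OF matM, of v w x] e1(2) e3 neq
      by (metis insert_commute)
    \<comment> \<open>An \<open>M\<close>-edge with an end missed by \<open>H\<close> lies in
      \<open>H'\<close>, which \<open>{x, y}\<close> does not.\<close>
    have "y \<in> \<Union>H" using M_edge_in_H'[of y x] e3 e3' by (auto simp: insert_commute)
    then obtain z where e4: "{y, z} \<in> H" using edge_at[OF matH] by blast
    have e24: "{w, x} \<noteq> {y, z}" using \<open>y \<noteq> w\<close> neq by (auto simp: doubleton_eq_iff)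
    have e4M: "{y, z} \<notin> M" 
      using matching_unique[OF matM e3, of "{y, z}" y] matching_unique[OF matH e2 e4, of x] e24
      by auto
    have e2M: "{w, x} \<notin> M"
      using matching_unique[OF matM e1(2), of "{w, x}" w] neq by auto
    have e3H: "{x, y} \<notin> H" using matching_unique[OF matH e2, of "{x, y}" x] \<open>y \<noteq> w\<close> neq by auto
    \<comment> \<open>Dropping \<open>{y, z}\<close> for \<open>{x, y}\<close> and recolouring \<open>v w x y\<close> gains an edge of \<open>M\<close>.\<close>
    let ?A = "{{w, x}, {y, z}}" and ?B = "{{v, w}, {x, y}}"
    let ?K = "(H - ?A) \<union> ?B" and ?K' = "(H' - {{v, w}}) \<union> {{w, x}}"
    have fin: "finite H" "finite H'" "finite M" using matH matH' matM finite_matching by blast+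
    have "matching E ?K"
      using matching_subset[OF matM, of ?B] e1 e2 e3 e4 v by (intro matching_exchange matH) auto
    moreover have "matching E ?K'"
      using matching_subset[OF matH, of "{{w, x}}"] e1 e2 x' by (intro matching_exchange matH') auto
    moreover have "?K \<inter> ?K' = {}" using disj e3' e2M e1 e3 by auto
    ultimately have B2: "(?K, ?K') \<in> B2 E" unfolding B2_def by auto
    have "card ?K + card ?A = card H + card ?B"
      using fin e2 e4 e3H v by (intro card_exchange) auto
    moreover have "card ?A = 2" "card ?B = 2"
      using e24 neq by (auto simp: doubleton_eq_iff)
    moreover have "card ?K' + card {{v, w}} = card H' + card {{w, x}}"
      using fin e1 e2 disj by (intro card_exchange) auto
    ultimately have le: "card (M \<inter> (?K \<union> ?K')) \<le> card (M \<inter> (H \<union> H'))"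
      using opt_inter[OF B2] by simp
    have "M \<inter> (?K \<union> ?K') = insert {x, y} (M \<inter> (H \<union> H'))"
      using e1 e3 e2M e4M by auto
    then show False using le fin e3H e3' by simp
  qed
  then show ?thesis using edge_at[OF matH'] that by blast
qed

section \<open>Alternating paths starting at vertices missed by \<open>H\<close>\<close>

definition path4 :: "'a \<Rightarrow> 'a \<Rightarrow> 'a \<Rightarrow> 'a \<Rightarrow> 'a \<Rightarrow> bool" where
  "path4 v w x y z \<longleftrightarrow> v \<notin> \<Union>H \<and> {v, w} \<in> H' \<and> {w, x} \<in> H \<and> {x, y} \<in> H' \<and> {y, z} \<in> H"

text \<open>A component ending at \<open>y\<close> would have two \<open>H'\<close>-edges and one
  \<open>H\<close>-edge, contradicting \<open>switch_le\<close>.\<close>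

lemma path4_exists:
  assumes v: "v \<notin> \<Union>H" and e1: "{v, w} \<in> H'" and e2: "{w, x} \<in> H" and e3: "{x, y} \<in> H'"
  obtains z where "path4 v w x y z"
proof -
  have "v \<noteq> x" "w \<noteq> x" using v e2 edge_neq[OF matH e2] by auto
  have "y \<in> \<Union>H"
  proof (rule ccontr)
    assume "y \<notin> \<Union>H"
    then have "card {{v, w}, {x, y}} \<le> card {{w, x}}"
      using v e1 e2 e3 by (intro switch_le) auto
    then show False using \<open>v \<noteq> x\<close> \<open>w \<noteq> x\<close> by (auto simp: doubleton_eq_iff)
  qed
  then show ?thesis using edge_at[OF matH] that v e1 e2 e3 unfolding path4_def by blast
qed

lemma path4_det:
  assumes "path4 v w x y z" "path4 v w' x' y' z'"
  shows "w' = w \<and> x' = x \<and> y' = y \<and> z' = z"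
  using assms mate_unique[OF matH] mate_unique[OF matH'] unfolding path4_def by metis

lemma path4_middle_H'_edge:
  assumes p: "path4 v w x y z" and q: "path4 v' w' x' y' z'"
    and "{x, y} = {x', y'}"
  shows "v = v'"
proof (cases "x = x'")
  case True
  then show ?thesis
    using p q mate_unique[OF matH] mate_unique[OF matH'] unfolding path4_def
    by (metis insert_commute)
next
  case False
  then have xy: "x' = y" "y' = x" using assms(3) by (auto simp: doubleton_eq_iff)
  \<comment> \<open>Here \<open>v w x y w' v'\<close> would be an odd path that can be switched.\<close>
  have P: "v \<notin> \<Union>H" "{v, w} \<in> H'" "{w, x} \<in> H" "{x, y} \<in> H'" "v' \<notin> \<Union>H"
    "{v', w'} \<in> H'" "{w', y} \<in> H" using p q xy unfolding path4_def by auto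
  let ?B = "{{v, w}, {x, y}, {v', w'}}" and ?A = "{{w, x}, {w', y}}"
  have "card ?B \<le> card ?A"
    using P by (intro switch_le) auto
  also have "\<dots> \<le> 2" by (simp add: card_insert_if)
  finally have "\<not> distinct [{v, w}, {x, y}, {v', w'}]"
    by (auto simp: card_insert_if split: if_splits)
  \<comment> \<open>The middle edge avoids \<open>v\<close> and \<open>v'\<close>, so the repetition
    is \<open>{v, w} = {v', w'}\<close>; since \<open>H\<close> covers \<open>w'\<close>, this gives
    \<open>v = v'\<close>.\<close>
  moreover have "v \<noteq> x" "v \<noteq> y" "v' \<noteq> x" "v' \<noteq> y" using P by auto
  moreover have "v \<noteq> w'" using P by auto
  ultimately show ?thesis by (auto simp: doubleton_eq_iff)
qed

text \<open>If the paths crossed this edge in opposite directions, the second would continue to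
  \<open>y' = v\<close>, but \<open>H\<close> covers \<open>y'\<close> and misses
  \<open>v\<close>.\<close>

lemma path4_first_H_edge:
  assumes p: "path4 v w x y z" and q: "path4 v' w' x' y' z'"
    and "{w, x} = {w', x'}"
  shows "v = v'"
proof (cases "w = w'")
  case True
  then show ?thesis
    using p q mate_unique[OF matH', of w v v'] unfolding path4_def by (metis insert_commute)
next
  case False
  then have "x' = w" using assms(3) by (auto simp: doubleton_eq_iff)
  then have "y' = v"
    using p q mate_unique[OF matH', of w v y'] unfolding path4_def by (metis insert_commute)
  then show ?thesis using p q unfolding path4_def by blast
qed

text \<open>Crossed in the same direction, the common edge would force \<open>x' = v\<close>,
  although \<open>H\<close> covers \<open>x'\<close>. In opposite directions the middle edges agree,
  so both paths coincide and \<open>{x', y'}\<close> would be a loop.\<close>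

lemma path4_H_edges_neq:
  assumes p: "path4 v w x y z" and q: "path4 v' w' x' y' z'"
  shows "{w, x} \<noteq> {y', z'}"
proof
  assume eq: "{w, x} = {y', z'}"
  show False
  proof (cases "w = y'")
    case True
    then have "x' = v"
      using p q mate_unique[OF matH', of w v x'] unfolding path4_def by (metis insert_commute)
    then show False using p q unfolding path4_def by blast
  next
    case False
    then have "x = y'" "w = z'" using eq by (auto simp: doubleton_eq_iff)
    then have "x' = y"
      using p q mate_unique[OF matH', of x y x'] unfolding path4_def by (metis insert_commute)
    then have "v = v'"
      using path4_middle_H'_edge[OF p q] \<open>x = y'\<close> by (auto simp: insert_commute)
    then have "x' = x" using path4_det p q by blast
    then show False
      using \<open>x = y'\<close> q edge_neq[OF matH', of x' y'] unfolding path4_def by blast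
  qed
qed

lemma path4_last_H_edge:
  assumes p: "path4 v w x y z" and q: "path4 v' w' x' y' z'"
    and "{y, z} = {y', z'}"
  shows "v = v'"
proof (cases "y = y'")
  case True
  then have "x = x'"
    using p q mate_unique[OF matH', of y x x'] unfolding path4_def by (metis insert_commute)
  then show ?thesis using path4_middle_H'_edge[OF p q] True by blast
next
  case False
  then have yz: "z = y'" "z' = y" using assms(3) by (auto simp: doubleton_eq_iff)
  \<comment> \<open>Here \<open>v w x y y' x' w' v'\<close> would be an odd path that can be switched.\<close>
  have P: "v \<notin> \<Union>H" "{v, w} \<in> H'" "{w, x} \<in> H" "{x, y} \<in> H'" "{y, y'} \<in> H"
    "v' \<notin> \<Union>H" "{v', w'} \<in> H'" "{w', x'} \<in> H" "{x', y'} \<in> H'"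
    using p q yz unfolding path4_def by auto
  let ?B = "{{v, w}, {x, y}, {x', y'}, {v', w'}}" and ?A = "{{w, x}, {y, y'}, {w', x'}}"
  have "card ?B \<le> card ?A"
    using P by (intro switch_le) auto
  also have "\<dots> \<le> 3" by (simp add: card_insert_if)
  finally have nd: "\<not> distinct [{v, w}, {x, y}, {x', y'}, {v', w'}]"
    by (auto simp: card_insert_if split: if_splits)
  have "{v, w} \<noteq> {x, y}" "{v, w} \<noteq> {x', y'}" "{v', w'} \<noteq> {x, y}" "{v', w'} \<noteq> {x', y'}"
    using P by (auto simp: doubleton_eq_iff)
  \<comment> \<open>Only the two mirror-image coincidences remain: equal middle edges or equal first
    edges.\<close>
  then have "{x, y} = {x', y'} \<or> {v, w} = {v', w'}" using nd
    unfolding distinct.simps list.set insert_iff empty_iff by metis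
  moreover have "v \<noteq> w'" using P by auto
  ultimately show ?thesis
    using path4_middle_H'_edge[OF p q] by (metis doubleton_eq_iff)
qed

text \<open>Each start is charged to the two \<open>H\<close>-edges of its path, and no edge is
  charged twice. The Boolean in \<open>r\<close> selects which of the two.\<close>

lemma card_path4_starts:
  assumes "finite S" "\<And>v. v \<in> S \<Longrightarrow> \<exists>w x y z. path4 v w x y z"
  shows "2 * card S \<le> card H"
proof -
  define r where "r = (\<lambda>(v, b) e. \<exists>w x y z. path4 v w x y z \<and> e = (if b then {w, x} else {y, z}))"
  have "card (S \<times> (UNIV :: bool set)) \<le> card H"
  proof (rule card_le_if_inj_on_rel[where r = r])
    show "finite H" using matH by (rule finite_matching)
    show "\<exists>e. e \<in> H \<and> r a e" if "a \<in> S \<times> UNIV" for a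
    proof -
      obtain v b where a: "a = (v, b)" by (cases a)
      have "v \<in> S" using that a by simp
      then obtain w x y z where p: "path4 v w x y z" using assms(2) by blast
      then have "(if b then {w, x} else {y, z}) \<in> H" unfolding path4_def by auto
      moreover have "r a (if b then {w, x} else {y, z})"
        using p unfolding r_def a prod.case by blast
      ultimately show ?thesis by blast
    qed
    show "a = a'" if re: "r a e" "r a' e" for a a' e
    proof -
      obtain v b v' b' where a: "a = (v, b)" "a' = (v', b')" by (cases a, cases a')
      obtain w x y z where p: "path4 v w x y z" "e = (if b then {w, x} else {y, z})"
        using re(1) unfolding r_def a prod.case by blast
      obtain w' x' y' z' where
        q: "path4 v' w' x' y' z'" "e = (if b' then {w', x'} else {y', z'})"
        using re(2) unfolding r_def a prod.case by blast
      have "b = b'"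
        using p(2) q(2) path4_H_edges_neq[OF p(1) q(1)] path4_H_edges_neq[OF q(1) p(1)]
        by (cases b; cases b') auto
      moreover have "v = v'"
        using p(2) q(2) \<open>b = b'\<close> path4_first_H_edge[OF p(1) q(1)] path4_last_H_edge[OF p(1) q(1)]
        by (cases b) auto
      ultimately show ?thesis using a by simp
    qed
  qed
  then show ?thesis by (simp add: card_cartesian_product mult.commute)
qed

section \<open>Counting the vertices of \<open>S\<close> and \<open>T\<close>\<close>

lemma card_M_le: "4 * card M \<le> 5 * card H"
proof -
  define S where "S = \<Union>M - \<Union>H"
  define T where "T = \<Union>H - \<Union>M"
  define r where "r = (\<lambda>v x. v \<notin> \<Union>H \<and> (\<exists>w. {v, w} \<in> H' \<and> {w, x} \<in> H))"
  define Q where "Q = {v \<in> S. \<exists>x \<in> T. r v x}"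
  have "finite (\<Union>E)" using finE card2 by (metis card.infinite finite_Union zero_neq_numeral)
  then have finV: "finite (\<Union>M)" "finite (\<Union>H)"
    using matM matH unfolding matching_def by (auto intro: finite_subset[OF Union_mono])
  then have fin: "finite S" "finite T" unfolding S_def T_def by blast+
  then have finQ: "finite Q" unfolding Q_def by simp
  have "card (\<Union>M) = card S + card (\<Union>M \<inter> \<Union>H)" "card (\<Union>H) = card T + card (\<Union>M \<inter> \<Union>H)"
    unfolding S_def T_def using finV
    by (subst card_Un_disjoint[symmetric]; auto intro: arg_cong[where f = card])+
  then have count: "card S + 2 * card H = card T + 2 * card M"
    using card_Union_matching[OF matM finE card2] card_Union_matching[OF matH finE card2] by simp
  have "card Q \<le> card T"
  proof (rule card_le_if_inj_on_rel[where r = r])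
    show "\<exists>x. x \<in> T \<and> r v x" if "v \<in> Q" for v using that unfolding Q_def by blast
    \<comment> \<open>Going back from \<open>x\<close>, the \<open>H\<close>-edge determines
      \<open>w\<close> and then the \<open>H'\<close>-edge determines \<open>v\<close>.\<close>
    show "v = v'" if "r v x" "r v' x" for v v' x
      using that mate_unique[OF matH] mate_unique[OF matH'] unfolding r_def
      by (metis insert_commute)
  qed fact
  moreover have "2 * card (S - Q) \<le> card H"
  proof (rule card_path4_starts)
    fix v assume v: "v \<in> S - Q"
    then have vH: "v \<notin> \<Union>H" and "v \<in> \<Union>M" unfolding S_def by auto
    then obtain w where w: "{v, w} \<in> M" using edge_at[OF matM] by blast
    then have w': "{v, w} \<in> H'" using M_edge_in_H' vH by blast
    then obtain x where x: "{w, x} \<in> H" using step_H vH by blast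
    then have "r v x" using vH w' unfolding r_def by blast
    then have "x \<notin> T" using v unfolding Q_def by blast
    then have "x \<in> \<Union>M" using x unfolding T_def by blast
    then obtain y where y: "{x, y} \<in> H'" using step_H'[OF vH w' w x] by blast
    obtain z where "path4 v w x y z" using path4_exists[OF vH w' x y] by blast
    then show "\<exists>w x y z. path4 v w x y z" by blast
  qed (use fin in auto)
  moreover have "card S = card (S - Q) + card Q"
    using fin finQ by (simp add: Q_def card_Diff_subset card_mono)
  \<comment> \<open>In integers, \<open>4 * (card M - card H) = 2 * (card S - card T) \<le> 2 * card
    (S - Q) \<le> card H\<close>.\<close>
  ultimately show ?thesis using count by linarith
qed

end

theorem theorem1:
  fixes V :: "'a set" and E :: "'a set set"
  assumes "finite_simple_graph V E" and "E \<noteq> {}"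
  shows "real (matching_number E) / real (alpha2 E) \<le> 5 / 4"
proof -
  have card2: "\<And>e. e \<in> E \<Longrightarrow> card e = 2" and finE: "finite E"
    using assms unfolding finite_simple_graph_def
    by (auto intro!: finite_subset[of E "Pow V"])
  have finP: "finite (Pow E)" using finE by simp
  have emp: "matching E {}" unfolding matching_def by simp
  have finB: "finite (B2 E)"
    by (rule finite_subset[of _ "Pow E \<times> Pow E"])
      (use finP in \<open>auto simp: B2_def matching_def\<close>)
  have B2_swap: "(K', K) \<in> B2 E" if "(K, K') \<in> B2 E" for K K'
    using that unfolding B2_def by auto
  define L where "L = {(K, K'). (K, K') \<in> B2 E \<and> card K + card K' = lambda2 E}"
  have finL: "finite L" unfolding L_def by (rule finite_subset[OF _ finB]) auto
  have sums: "{card H + card H' | H H'. (H, H') \<in> B2 E} = (\<lambda>(H, H'). card H + card H') ` B2 E"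
    by auto
  have "({}, {}) \<in> B2 E" using emp unfolding B2_def by auto
  then have "lambda2 E \<in> (\<lambda>(H, H'). card H + card H') ` B2 E"
    unfolding lambda2_def sums using finB by (intro Max_in) auto
  then have neL: "L \<noteq> {}" unfolding L_def by force
  have sum_le: "card K + card K' \<le> lambda2 E" if "(K, K') \<in> B2 E" for K K'
    unfolding lambda2_def sums using finB that by (intro Max_ge) force+
  let ?U = "\<Union>(H, H') \<in> L. {card H, card H'}"
  have alpha: "alpha2 E = Max ?U" unfolding alpha2_def L_def ..
  have finU: "finite ?U" using finL by auto
  have alpha_ge: "card K \<le> alpha2 E" if "(K, K') \<in> L" for K K'
    unfolding alpha using finU that by (intro Max_ge) auto
  have "alpha2 E \<in> ?U" unfolding alpha using finU neL by (intro Max_in) auto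
  then obtain J J' where J: "(J, J') \<in> L" "card J = alpha2 E \<or> card J' = alpha2 E" by auto
  \<comment> \<open>The maximum may be attained by the second matching; swapping puts it
    first.\<close>
  have "(J', J) \<in> L" using J(1) B2_swap unfolding L_def by (auto simp: add.commute)
  then obtain K K' where K: "(K, K') \<in> L" "card K = alpha2 E" using J by blast
  have "finite {card M | M. matching E M}"
    by (rule finite_surj[OF finP, of _ card]) (auto simp: matching_def)
  then have "matching_number E \<in> {card M | M. matching E M}"
    unfolding matching_number_def using emp by (intro Max_in) auto
  then obtain M where M: "matching E M" "card M = matching_number E" by auto
  \<comment> \<open>Among these pairs, maximising \<open>f\<close> supplies the last condition of
    the locale.\<close>
  define R where "R = {(K, K') \<in> L. card K = alpha2 E}"
  define f where "f = (\<lambda>(K, K'). card (M \<inter> (K \<union> K')))"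
  have "finite R" "R \<noteq> {}" using finL K unfolding R_def by (auto intro: finite_subset[OF _ finL])
  then obtain p where p: "p \<in> R" "\<And>q. q \<in> R \<Longrightarrow> f q \<le> f p"
    using obtains_MAX[of R f] by (metis Max_ge finite_imageI imageI)
  obtain H H' where HH: "p = (H, H')" by (cases p)
  have HR: "(H, H') \<in> B2 E" "card H + card H' = lambda2 E" "card H = alpha2 E"
    using p(1) unfolding HH R_def L_def by auto
  interpret optimal_triple E H H' M
  proof
    fix K K' assume B2: "(K, K') \<in> B2 E"
    show "card K + card K' \<le> card H + card H'" using sum_le[OF B2] HR by simp
    show "card K \<le> card H" if "card K + card K' = card H + card H'"
      using that alpha_ge[of K K'] B2 HR unfolding L_def by simp
    show "card (M \<inter> (K \<union> K')) \<le> card (M \<inter> (H \<union> H'))" if "card K = card H" "card K' = card H'"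
      using that p(2)[of "(K, K')"] B2 HR unfolding R_def L_def f_def HH by simp
  qed (use finE card2 HR M in \<open>auto simp: B2_def\<close>)
  have "4 * matching_number E \<le> 5 * alpha2 E" using card_M_le M HR by simp
  then have "4 * real (matching_number E) \<le> 5 * real (alpha2 E)" by linarith
  \<comment> \<open>For \<open>alpha2 E = 0\<close> the quotient is 0 by the convention for division
    by zero.\<close>
  then show ?thesis by (cases "alpha2 E = 0") (simp_all add: field_simps)
qed

end
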